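(* Let $m\ge 1$ be odd. Then the natural map $\pi:C(V,q)\to SO(V,q)$ restricted to $Pin(V,q)$, and hence also restricted to $Spin(V,q)$, is injective.
   Context: $R=\mathbb{F}_2[s,s^{-1}]$ with $s$ an indeterminate, $t=s^2$. $V$ is the free $R$-module with basis $u,v_1,\dots,v_m$. The symplectic (alternating) bilinear form $(\cdot,\cdot)$ on $V$ is given by $(u,v_i)=(v_i,v_j)=1$ for all $i$ and all $j\neq i$, and $q$ is the quadratic form with associated bilinear form $(\cdot,\cdot)$ and $q(u)=1$, $q(v_1)=\dots=q(v_m)=t^{-1}$. $SO(V,q)=GO(V,q)$ is the group of $R$-module automorphisms of $V$ preserving $q$. $Cl=Cl(V,q)$ is the Clifford algebra, the quotient of the tensor algebra $T(V)$ by the ideal generated by the relations $w^2=q(w)$, $w\in V$; $V$ and $R$ are regarded as subsets of $Cl$. It is $\mathbb{Z}_2$-graded, $Cl=Cl^0\oplus Cl^1$. $x\mapsto\overline{x}$ is the anti-automorphism of $Cl$ reversing products of vectors (Clifford conjugation; in characteristic two it is just the transpose map $w_1\cdots w_k\mapsto w_k\cdots w_1$). The Clifford group is $C(V,q)=\{c\in Cl^\times : c^{-1}vc\in V \text{ for all } v\in V\}$, and $\pi:C(V,q)\to GO(V,q)$ sends $c$ to the map $v\mapsto c^{-1}vc$ (maps acting on the right). $Pin(V,q)=\{c\in C(V,q): c\overline{c}=1\}$ and $Spin(V,q)=Pin(V,q)\cap Cl^0$. *)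

theory Defs
  imports "HOL-Analysis.Analysis" "HOL-Library.Poly_Mapping" "HOL-Library.Z2"
begin

section \<open>The ground ring and the quadratic module\<close>

text \<open>The ring of Laurent polynomials over the field with two elements is the group algebra of
  the integers: \<^term>\<open>Poly_Mapping.single k a\<close> stands for \<open>a s\<^sup>k\<close>, and multiplication is
  convolution.\<close>

type_synonym laurent = "int \<Rightarrow>\<^sub>0 bit"

definition s_pow :: "int \<Rightarrow> laurent" where
  "s_pow k = Poly_Mapping.single k 1"

definition t_pow :: "int \<Rightarrow> laurent" where
  "t_pow k = s_pow (2 * k)"

text \<open>The number \<open>m\<close> is the cardinality of a finite index type \<open>'m\<close>. The basis of \<open>V\<close> is indexed
  by \<open>'m option\<close>, where \<^const>\<open>None\<close> is the index of \<open>u\<close> and \<open>Some i\<close> that of \<open>v\<^sub>i\<close>.\<close>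

type_synonym 'm V = "laurent ^ ('m option)"

definition u_vec :: "'m::finite V" where
  "u_vec = axis None 1"

definition v_vec :: "'m::finite \<Rightarrow> 'm V" where
  "v_vec i = axis (Some i) 1"

definition bform :: "'m::finite V \<Rightarrow> 'm V \<Rightarrow> laurent" where
  "bform x y = (\<Sum>a\<in>UNIV. \<Sum>b\<in>UNIV - {a}. x $ a * y $ b)"

definition qdiag :: "'m option \<Rightarrow> laurent" where
  "qdiag b = (case b of None \<Rightarrow> 1 | Some _ \<Rightarrow> t_pow (- 1))"

text \<open>Since any two different basis vectors pair to 1, each two-element set \<open>{a, b}\<close> of
  indices contributes \<open>x\<^sub>a x\<^sub>b\<close> to \<open>q(x)\<close>. That this is the quadratic form prescribed by
  \<^const>\<open>bform\<close> and the values on the basis is shown below.\<close>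

definition qform :: "'m::finite V \<Rightarrow> laurent" where
  "qform x = (\<Sum>b\<in>UNIV. qdiag b * (x $ b)\<^sup>2) + (\<Sum>P | card P = 2. \<Prod>b\<in>P. x $ b)"

lemma laurent_double: "x + x = 0" for x :: laurent
proof (rule poly_mapping_eqI)
  fix k
  have "a + a = 0" for a :: bit
    by (cases a) simp_all
  then show "Poly_Mapping.lookup (x + x) k = Poly_Mapping.lookup 0 k"
    by (simp only: lookup_add lookup_zero)
qed

lemma bform_axis: "bform (axis a 1) (axis b 1) = (if a = b then 0 else 1)"
proof -
  have "bform (axis a 1) (axis b 1) =
      (\<Sum>c\<in>UNIV. if c = a then (\<Sum>d\<in>UNIV - {a}. if d = b then 1 else 0) else 0)"
    unfolding bform_def by (rule sum.cong) (auto simp: axis_def intro!: sum.cong)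
  also have "\<dots> = (if a = b then 0 else 1)"
    by simp
  finally show ?thesis .
qed

lemma bform_u_v: "bform u_vec (v_vec i) = 1"
  by (simp add: bform_axis u_vec_def v_vec_def)

lemma bform_v_u: "bform (v_vec i) u_vec = 1"
  by (simp add: bform_axis u_vec_def v_vec_def)

lemma bform_v_v: "bform (v_vec i) (v_vec j) = (if i = j then 0 else 1)"
  by (simp add: bform_axis v_vec_def)

lemma qform_axis: "qform (axis a 1) = qdiag a"
proof -
  have "(\<Sum>b\<in>UNIV. qdiag b * ((axis a 1 :: 'a V) $ b)\<^sup>2) = (\<Sum>b\<in>UNIV. if b = a then qdiag b else 0)"
    by (rule sum.cong) (auto simp: axis_def)
  moreover have "(\<Prod>b\<in>P. (axis a 1 :: 'a V) $ b) = 0" if "card P = 2" for P :: "'a option set"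
  proof -
    have "\<not> P \<subseteq> {a}"
      using that card_mono[of "{a}" P] by auto
    then obtain b where "b \<in> P" "b \<noteq> a"
      by auto
    then show ?thesis
      using that by (intro prod_zero) (auto simp: axis_def card_ge_0_finite)
  qed
  then have "(\<Sum>P | card P = 2. \<Prod>b\<in>P. (axis a 1 :: 'a V) $ b) = 0"
    by (intro sum.neutral) blast
  ultimately show ?thesis
    by (simp add: qform_def)
qed

lemma qform_u: "qform u_vec = 1"
  by (simp add: qform_axis u_vec_def qdiag_def)

lemma qform_v: "qform (v_vec i) = t_pow (- 1)"
  by (simp add: qform_axis v_vec_def qdiag_def)

lemma qform_scale: "qform (r *s x) = r\<^sup>2 * qform x"
proof -
  have "(\<Prod>b\<in>P. (r *s x) $ b) = r\<^sup>2 * (\<Prod>b\<in>P. x $ b)" if "card P = 2" for P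
    using that by (simp add: prod.distrib)
  then show ?thesis
    by (simp add: qform_def distrib_left sum_distrib_left power_mult_distrib mult_ac)
qed

lemma sum_two_element_sets:
  fixes f :: "'b::finite \<Rightarrow> 'b \<Rightarrow> 'c::comm_monoid_add"
  shows "(\<Sum>P | card P = 2. \<Sum>a\<in>P. \<Sum>b\<in>P - {a}. f a b) = (\<Sum>a\<in>UNIV. \<Sum>b\<in>UNIV - {a}. f a b)"
proof -
  have "(\<Sum>P | card P = 2. \<Sum>a\<in>P. \<Sum>b\<in>P - {a}. f a b)
      = (\<Sum>(P, a, b)\<in>(SIGMA P : {P. card P = 2}. SIGMA a : P. P - {a}). f a b)"
    by (simp add: sum.Sigma)
  also have "\<dots> = (\<Sum>(a, b)\<in>(SIGMA a : UNIV. UNIV - {a}). f a b)"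
    by (rule sum.reindex_bij_witness[where i = "\<lambda>(a, b). ({a, b}, a, b)" and j = snd])
      (auto simp: card_2_iff)
  also have "\<dots> = (\<Sum>a\<in>UNIV. \<Sum>b\<in>UNIV - {a}. f a b)"
    by (simp add: sum.Sigma)
  finally show ?thesis .
qed

lemma qform_add: "qform (x + y) = qform x + qform y + bform x y"
proof -
  have "(\<Prod>b\<in>P. (x + y) $ b) =
      (\<Prod>b\<in>P. x $ b) + (\<Prod>b\<in>P. y $ b) + (\<Sum>a\<in>P. \<Sum>b\<in>P - {a}. x $ a * y $ b)"
    if "card P = 2" for P
  proof -
    from that obtain a b where P: "P = {a, b}" "a \<noteq> b"
      by (auto simp: card_2_iff)
    then have "P - {a} = {b}" "P - {b} = {a}"
      by auto
    with P show ?thesis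
      by (simp add: algebra_simps)
  qed
  then have "(\<Sum>P | card P = 2. \<Prod>b\<in>P. (x + y) $ b) =
      (\<Sum>P | card P = 2. \<Prod>b\<in>P. x $ b) + (\<Sum>P | card P = 2. \<Prod>b\<in>P. y $ b) + bform x y"
    by (simp add: sum.distrib sum_two_element_sets bform_def)
  moreover have "(r + s)\<^sup>2 = r\<^sup>2 + s\<^sup>2" for r s :: laurent
    using laurent_double[of "r * s"] by (simp add: power2_eq_square algebra_simps)
  ultimately show ?thesis
    by (simp add: qform_def distrib_left sum.distrib algebra_simps)
qed

lemma bform_self: "bform x x = 0" for x :: "'m::finite V"
proof -
  have "x + x = 0"
    by (simp only: vec_eq_iff vector_add_component laurent_double zero_index simp_thms)
  moreover have "qform (0 :: 'm V) = 0"
    using qform_scale[of 0 0] by simp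
  ultimately show ?thesis
    using qform_add[of x x] by (simp only: laurent_double add_0)
qed

lemma qform_unique:
  fixes Q :: "'m::finite V \<Rightarrow> laurent"
  assumes scale: "\<And>r x. Q (r *s x) = r\<^sup>2 * Q x"
    and add: "\<And>x y. Q (x + y) = Q x + Q y + bform x y"
    and u: "Q u_vec = 1" and v: "\<And>i. Q (v_vec i) = t_pow (- 1)"
  shows "Q = qform"
proof
  fix x :: "'m V"
  define D where "D y = Q y - qform y" for y
  have D_add: "D (y + z) = D y + D z" for y z
    by (simp add: D_def add qform_add)
  have D_scale: "D (r *s y) = r\<^sup>2 * D y" for r y
    by (simp add: D_def scale qform_scale right_diff_distrib)
  have D_zero: "D 0 = 0"
    using D_scale[of 0 0] by simp
  have D_sum: "D (\<Sum>i\<in>A. f i) = (\<Sum>i\<in>A. D (f i))" if "finite A" for A and f :: "'m option \<Rightarrow> 'm V"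
    using that by induction (simp_all add: D_zero D_add)
  have "D (axis b 1) = 0" for b
    using u v by (cases b) (simp_all add: D_def qform_u qform_v flip: u_vec_def v_vec_def)
  then have "D (\<Sum>b\<in>UNIV. x $ b *s axis b 1) = 0"
    by (simp add: D_sum D_scale)
  moreover have "(\<Sum>b\<in>UNIV. x $ b *s axis b 1) = x"
    by (simp add: vec_eq_iff axis_def if_distrib cong: if_cong)
  ultimately show "Q x = qform x"
    by (simp add: D_def)
qed

definition orthogonal_group :: "('m::finite V \<Rightarrow> 'm V) set" where
  "orthogonal_group = {f. module_hom (*s) (*s) f \<and> bij f \<and> (\<forall>x. qform (f x) = qform x)}"


section \<open>The tensor algebra\<close>

text \<open>As \<open>V\<close> is free on \<open>'m option\<close>, its tensor algebra is the free associative algebra on that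
  index type, that is, the monoid algebra of the free monoid of words, written additively
  as \<^typ>\<open>('a, 'b) poly_mapping\<close> expects.\<close>

datatype 'b free_word = FW (letters: "'b list")

instantiation free_word :: (type) monoid_add
begin

definition zero_free_word :: "'a free_word" where
  "0 = FW []"

definition plus_free_word :: "'a free_word \<Rightarrow> 'a free_word \<Rightarrow> 'a free_word" where
  "v + w = FW (letters v @ letters w)"

instance
  by standard (simp_all add: zero_free_word_def plus_free_word_def)

end

type_synonym 'm tensor = "'m option free_word \<Rightarrow>\<^sub>0 laurent"

definition tensor_scalar :: "laurent \<Rightarrow> 'm tensor" where
  "tensor_scalar r = Poly_Mapping.single 0 r"

definition tensor_vec :: "'m::finite V \<Rightarrow> 'm tensor" where
  "tensor_vec x = (\<Sum>b\<in>UNIV. Poly_Mapping.single (FW [b]) (x $ b))"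

definition reverse_word :: "'b free_word \<Rightarrow> 'b free_word" where
  "reverse_word w = FW (rev (letters w))"

definition tensor_transpose :: "'m tensor \<Rightarrow> 'm tensor" where
  "tensor_transpose = Poly_Mapping.map_key reverse_word"

lemma inj_reverse_word: "inj reverse_word"
  by (rule injI) (simp add: reverse_word_def free_word.expand)

lemma tensor_transpose_add: "tensor_transpose (x + y) = tensor_transpose x + tensor_transpose y"
  by (simp add: tensor_transpose_def map_key_plus inj_reverse_word)

lemma tensor_transpose_diff: "tensor_transpose (x - y) = tensor_transpose x - tensor_transpose y"
  by (metis add_diff_cancel diff_add_cancel tensor_transpose_add)

lemma tensor_transpose_zero: "tensor_transpose 0 = 0"
  by (simp add: tensor_transpose_def inj_reverse_word)

lemma tensor_transpose_sum: "tensor_transpose (\<Sum>i\<in>A. f i) = (\<Sum>i\<in>A. tensor_transpose (f i))"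
  by (induction A rule: infinite_finite_induct)
    (simp_all add: tensor_transpose_add tensor_transpose_zero)

lemma tensor_transpose_single:
  "tensor_transpose (Poly_Mapping.single w r) = Poly_Mapping.single (reverse_word w) r"
  using map_key_single[OF inj_reverse_word, of "reverse_word w" r]
  by (simp add: tensor_transpose_def reverse_word_def)

lemma tensor_transpose_scalar: "tensor_transpose (tensor_scalar r) = tensor_scalar r"
  by (simp add: tensor_scalar_def tensor_transpose_single reverse_word_def zero_free_word_def)

lemma tensor_transpose_vec: "tensor_transpose (tensor_vec x) = tensor_vec x"
  by (simp add: tensor_vec_def tensor_transpose_sum tensor_transpose_single reverse_word_def)

lemma tensor_transpose_mult: "tensor_transpose (x * y) = tensor_transpose y * tensor_transpose x"
proof (induction x rule: update_induct)
  case const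
  show ?case
    by (simp add: tensor_transpose_zero)
next
  case (update x v r)
  have x: "Poly_Mapping.update v r x = x + Poly_Mapping.single v r"
    using update(1)
    by (intro poly_mapping_eqI) (auto simp: lookup_update lookup_add lookup_single in_keys_iff when_def)
  have "tensor_transpose (Poly_Mapping.single v r * y)
      = tensor_transpose y * tensor_transpose (Poly_Mapping.single v r)"
  proof (induction y rule: update_induct)
    case const
    show ?case
      by (simp add: tensor_transpose_zero)
  next
    case (update y w s)
    have y: "Poly_Mapping.update w s y = y + Poly_Mapping.single w s"
      using update(1)
      by (intro poly_mapping_eqI) (auto simp: lookup_update lookup_add lookup_single in_keys_iff when_def)
    show ?case
      using update(3)
      by (simp add: y distrib_left distrib_right tensor_transpose_add mult_single
          tensor_transpose_single reverse_word_def plus_free_word_def mult.commute[of r s])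
  qed
  then show ?case
    using update(3) by (simp add: x distrib_left distrib_right tensor_transpose_add)
qed


section \<open>The Clifford algebra\<close>

text \<open>The two-sided ideal generated by the elements \<open>w \<otimes> w - q(w)\<close>: it consists of the finite
  sums of two-sided multiples of these generators.\<close>

inductive_set clifford_ideal :: "'m::finite tensor set" where
  generator:
    "x * (tensor_vec w * tensor_vec w - tensor_scalar (qform w)) * y \<in> clifford_ideal"
| add: "x \<in> clifford_ideal \<Longrightarrow> y \<in> clifford_ideal \<Longrightarrow> x + y \<in> clifford_ideal"

lemma clifford_ideal_zero: "0 \<in> clifford_ideal"
  using clifford_ideal.generator[of 0 _ 0] by simp

lemma clifford_ideal_mult:
  assumes "x \<in> clifford_ideal"
  shows "a * x * b \<in> clifford_ideal"
  using assms
proof induction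
  case (generator x w y)
  have "a * (x * (tensor_vec w * tensor_vec w - tensor_scalar (qform w)) * y) * b
      = (a * x) * (tensor_vec w * tensor_vec w - tensor_scalar (qform w)) * (y * b)"
    by (simp only: mult.assoc)
  then show ?case
    using clifford_ideal.generator by metis
next
  case (add x y)
  then show ?case
    by (simp only: distrib_left distrib_right clifford_ideal.add)
qed

lemma clifford_ideal_uminus:
  assumes "x \<in> clifford_ideal"
  shows "- x \<in> clifford_ideal"
  using clifford_ideal_mult[OF assms, of "- 1" 1] by simp

lemma clifford_ideal_diff:
  assumes "x \<in> clifford_ideal" "y \<in> clifford_ideal"
  shows "x - y \<in> clifford_ideal"
  using clifford_ideal.add[OF assms(1) clifford_ideal_uminus[OF assms(2)]] by simp

lemma clifford_ideal_transpose:
  assumes "x \<in> clifford_ideal"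
  shows "tensor_transpose x \<in> clifford_ideal"
  using assms
proof induction
  case (generator x w y)
  show ?case
    using clifford_ideal.generator[of "tensor_transpose y" w "tensor_transpose x"]
    by (simp add: tensor_transpose_mult tensor_transpose_diff tensor_transpose_vec
        tensor_transpose_scalar mult.assoc)
next
  case (add x y)
  then show ?case
    by (simp add: tensor_transpose_add clifford_ideal.add)
qed

quotient_type (overloaded) 'm clifford =
  "('m::finite) tensor" / "\<lambda>x y. x - y \<in> clifford_ideal"
  morphisms rep_clifford clifford_of
proof (rule equivpI)
  show "reflp (\<lambda>x y :: 'm tensor. x - y \<in> clifford_ideal)"
    by (simp add: reflp_def clifford_ideal_zero)
  show "symp (\<lambda>x y :: 'm tensor. x - y \<in> clifford_ideal)"
    by (rule sympI) (use clifford_ideal_uminus in fastforce)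
  show "transp (\<lambda>x y :: 'm tensor. x - y \<in> clifford_ideal)"
    by (rule transpI) (use clifford_ideal.add in fastforce)
qed

instantiation clifford :: (finite) ring
begin

lift_definition zero_clifford :: "'a clifford" is "0" .

lift_definition plus_clifford :: "'a clifford \<Rightarrow> 'a clifford \<Rightarrow> 'a clifford" is "(+)"
  subgoal for a b c d using clifford_ideal.add[of "a - b" "c - d"] by (simp add: algebra_simps)
  done

lift_definition minus_clifford :: "'a clifford \<Rightarrow> 'a clifford \<Rightarrow> 'a clifford" is "(-)"
  subgoal for a b c d using clifford_ideal_diff[of "a - b" "c - d"] by (simp add: algebra_simps)
  done

lift_definition uminus_clifford :: "'a clifford \<Rightarrow> 'a clifford" is "uminus"
  subgoal for a b using clifford_ideal_uminus[of "a - b"] by simp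
  done

lift_definition times_clifford :: "'a clifford \<Rightarrow> 'a clifford \<Rightarrow> 'a clifford" is "(*)"
  subgoal for a b c d
    using clifford_ideal.add[OF clifford_ideal_mult[of "a - b" 1 c] clifford_ideal_mult[of "c - d" b 1]]
    by (simp add: algebra_simps)
  done

instance
  by standard (transfer; simp add: algebra_simps clifford_ideal_zero)+

end

text \<open>The unit is provided by \<^class>\<open>monoid_mult\<close> instead of \<^class>\<open>ring_1\<close>, since the latter
  requires \<open>0 \<noteq> 1\<close>, which depends on the properness of the ideal.\<close>

instantiation clifford :: (finite) monoid_mult
begin

lift_definition one_clifford :: "'a clifford" is "1" .

instance
  by standard (transfer; simp add: clifford_ideal_zero)+

end

lift_definition cl_scalar :: "laurent \<Rightarrow> 'm::finite clifford" is tensor_scalar .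

lift_definition cl_vec :: "'m::finite V \<Rightarrow> 'm clifford" is tensor_vec .

lemma cl_vec_square: "cl_vec w * cl_vec w = cl_scalar (qform w)"
  by transfer (use clifford_ideal.generator[of 1 _ 1] in simp)

definition cl_even :: "'m::finite clifford set" where
  "cl_even = clifford_of ` {x. \<forall>w\<in>Poly_Mapping.keys x. even (length (letters w))}"

lift_definition cl_conj :: "'m::finite clifford \<Rightarrow> 'm clifford" is tensor_transpose
  using clifford_ideal_transpose by (force simp flip: tensor_transpose_diff)


section \<open>Clifford, pin and spin groups\<close>

text \<open>\<open>R\<close> and \<open>V\<close> are regarded as subsets of the Clifford algebra through \<^const>\<open>cl_scalar\<close>
  and \<^const>\<open>cl_vec\<close>, so \<open>c\<inverse> v c \<in> V\<close> is membership in \<^term>\<open>range cl_vec\<close>. The map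
  \<open>clifford_pi c\<close> is read back on \<open>V\<close>.\<close>

definition cl_units :: "'m::finite clifford set" where
  "cl_units = {c. \<exists>d. c * d = 1 \<and> d * c = 1}"

definition cl_inv :: "'m::finite clifford \<Rightarrow> 'm clifford" where
  "cl_inv c = (THE d. c * d = 1 \<and> d * c = 1)"

definition clifford_group :: "'m::finite clifford set" where
  "clifford_group = {c \<in> cl_units. \<forall>x. cl_inv c * cl_vec x * c \<in> range cl_vec}"

definition pin_group :: "'m::finite clifford set" where
  "pin_group = {c \<in> clifford_group. c * cl_conj c = 1}"

definition spin_group :: "'m::finite clifford set" where
  "spin_group = pin_group \<inter> cl_even"

definition clifford_pi :: "'m::finite clifford \<Rightarrow> 'm V \<Rightarrow> 'm V" where
  "clifford_pi c x = inv cl_vec (cl_inv c * cl_vec x * c)"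

lemma cl_vec_clifford_pi:
  assumes "c \<in> clifford_group"
  shows "cl_vec (clifford_pi c x) = cl_inv c * cl_vec x * c"
  using assms by (simp add: clifford_group_def clifford_pi_def f_inv_into_f)

end

theory Submission
  imports Defs
begin

text \<open>If \<open>c\<close> and \<open>d\<close> induce the same map on \<open>V\<close>, then \<open>c d\<inverse>\<close> commutes with every vector.
  For odd \<open>m\<close> the elements of \<open>Cl\<close> with this property are the scalars, so \<open>c = r d\<close> with
  \<open>r \<in> R\<close>. Multiplying \<open>c\<close> and \<open>d\<close> by their conjugates gives \<open>r\<^sup>2 = 1\<close> when both lie in the pin
  group, and \<open>r = 1\<close> follows, as \<open>R\<close> is a domain of characteristic two.

  The parity of \<open>m\<close> enters through the Gram matrix of the basis, \<open>J - I\<close> of size \<open>m + 1\<close> with \<open>J\<close>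
  the all-ones matrix: modulo 2 its square is \<open>(m + 1) J + I = I\<close>. Hence there is a dual basis
  with coordinates in \<open>R\<close> (\<open>bform_dual_vec\<close>). The commutator with the dual vector of a basis
  vector \<open>e\<close> is a derivation of \<open>Cl\<close>, to be thought of as \<open>\<partial>/\<partial>e\<close>. An element killed by all these
  derivations involves no basis vector and is therefore a scalar (\<open>centralizer_of_dual_basis\<close>).

  All this takes place inside \<open>Cl\<close>; to return to \<open>R\<close> and \<open>V\<close> one needs that they embed in \<open>Cl\<close>.
  For \<open>R\<close> this is shown by letting \<open>Cl\<close> act on the exterior algebra of \<open>V\<close> (\<open>inj_cl_scalar\<close>), and
  for \<open>V\<close> it follows because the bilinear form is nondegenerate (\<open>inj_cl_vec\<close>).

  The maps induced by the Clifford group preserve \<open>q\<close>, since \<open>(c\<inverse> v c)\<^sup>2 = q(v)\<close>. Their surjectivity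
  again comes from the centralizer: a vector \<open>z\<close> orthogonal to the image commutes with
  \<open>c\<inverse> V c\<close>, so \<open>c z c\<inverse>\<close> commutes with \<open>V\<close> and is a scalar; thus \<open>z\<close> is a scalar, and
  nondegeneracy forces \<open>z = 0\<close> (\<open>clifford_pi_perp\<close>).\<close>

section \<open>Modules over the tensor algebra\<close>

lemma module_vec: "module ((*s) :: laurent \<Rightarrow> laurent ^ 'n \<Rightarrow> laurent ^ 'n)"
  by unfold_locales (simp_all add: vec_eq_iff algebra_simps)

lemma tensor_induct [case_names single add]:
  fixes x :: "'m tensor"
  assumes single: "\<And>w r. P (Poly_Mapping.single w r)"
    and add: "\<And>x y. P x \<Longrightarrow> P y \<Longrightarrow> P (x + y)"
  shows "P x"
proof (induction x rule: update_induct)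
  case const
  show ?case
    using single[of 0 0] by simp
next
  case (update x w r)
  have "Poly_Mapping.update w r x = x + Poly_Mapping.single w r"
    using update(1)
    by (intro poly_mapping_eqI) (auto simp: lookup_update lookup_add lookup_single in_keys_iff when_def)
  then show ?case
    using add[OF update(3) single] by simp
qed

text \<open>The module structure given by the universal property of the tensor algebra: the basis vector
  with index \<open>b\<close> acts by the operator \<open>T b\<close>, and words act by composition.\<close>

definition tensor_action ::
    "('m option \<Rightarrow> laurent ^ 'n \<Rightarrow> laurent ^ 'n) \<Rightarrow> 'm tensor \<Rightarrow> laurent ^ 'n \<Rightarrow> laurent ^ 'n" where
  "tensor_action T x f =
    (\<Sum>w\<in>Poly_Mapping.keys x. Poly_Mapping.lookup x w *s foldr T (letters w) f)"

lemma tensor_action_superset: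
  assumes "finite K" "Poly_Mapping.keys x \<subseteq> K"
  shows "tensor_action T x f = (\<Sum>w\<in>K. Poly_Mapping.lookup x w *s foldr T (letters w) f)"
  unfolding tensor_action_def
  by (rule sum.mono_neutral_left) (use assms in \<open>auto simp: in_keys_iff\<close>)

lemma tensor_action_add: "tensor_action T (x + y) f = tensor_action T x f + tensor_action T y f"
proof -
  let ?K = "Poly_Mapping.keys x \<union> Poly_Mapping.keys y"
  have "tensor_action T z f = (\<Sum>w\<in>?K. Poly_Mapping.lookup z w *s foldr T (letters w) f)"
    if "z \<in> {x, y, x + y}" for z
    using that keys_add[of x y] by (intro tensor_action_superset) auto
  then show ?thesis
    by (simp add: lookup_add vector_sadd_rdistrib sum.distrib)
qed

lemma tensor_action_zero: "tensor_action T 0 f = 0"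
  by (simp add: tensor_action_def)

lemma tensor_action_diff: "tensor_action T (x - y) f = tensor_action T x f - tensor_action T y f"
  by (metis add_diff_cancel diff_add_cancel tensor_action_add)

lemma tensor_action_sum: "tensor_action T (\<Sum>i\<in>A. g i) f = (\<Sum>i\<in>A. tensor_action T (g i) f)"
  by (induction A rule: infinite_finite_induct) (simp_all add: tensor_action_zero tensor_action_add)

lemma tensor_action_single:
  "tensor_action T (Poly_Mapping.single w r) f = r *s foldr T (letters w) f"
  by (cases "r = 0") (simp_all add: tensor_action_def)

lemma tensor_action_scalar: "tensor_action T (tensor_scalar r) f = r *s f"
  by (simp add: tensor_scalar_def tensor_action_single zero_free_word_def)

lemma tensor_action_vec: "tensor_action T (tensor_vec x) f = (\<Sum>b\<in>UNIV. x $ b *s T b f)"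
  by (simp add: tensor_vec_def tensor_action_sum tensor_action_single)

lemma module_hom_foldr:
  assumes "\<And>b. module_hom (*s) (*s) (T b :: laurent ^ 'n \<Rightarrow> laurent ^ 'n)"
  shows "module_hom (*s) (*s) (foldr T bs)"
proof (induction bs)
  case Nil
  show ?case
    by (simp add: module_hom_iff module_vec)
next
  case (Cons b bs)
  then show ?case
    using assms[of b] by (simp add: module_hom_iff)
qed

lemma module_hom_tensor_action:
  assumes "\<And>b. module_hom (*s) (*s) (T b :: laurent ^ 'n \<Rightarrow> laurent ^ 'n)"
  shows "module_hom (*s) (*s) (tensor_action T x)"
  using module_hom_foldr[of T, OF assms]
  by (simp add: module_hom_iff tensor_action_def sum.distrib vec_eq_iff distrib_left sum_distrib_left mult.left_commute)

lemma tensor_action_mult: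
  assumes T: "\<And>b. module_hom (*s) (*s) (T b :: laurent ^ 'n \<Rightarrow> laurent ^ 'n)"
  shows "tensor_action T (x * y) f = tensor_action T x (tensor_action T y f)"
proof (induction x rule: tensor_induct)
  case (single v r)
  show ?case
  proof (induction y rule: tensor_induct)
    case (single w s)
    show ?case
      using module_hom_foldr[of T "letters v", OF T]
      by (simp add: mult_single tensor_action_single plus_free_word_def module_hom_iff vector_smult_assoc)
  next
    case (add y z)
    then show ?case
      using module_hom_tensor_action[of T, OF T]
      by (simp add: distrib_left tensor_action_add module_hom_iff)
  qed
next
  case (add x z)
  then show ?case
    by (simp add: distrib_right tensor_action_add)
qed

text \<open>The universal property of the Clifford algebra, in the form in which an element is shown to
  be nonzero there: it acts nontrivially on some module.\<close>

lemma tensor_action_clifford_ideal: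
  assumes T: "\<And>b. module_hom (*s) (*s) (T b :: laurent ^ 'n \<Rightarrow> laurent ^ 'n)"
    and square: "\<And>v g. tensor_action T (tensor_vec v) (tensor_action T (tensor_vec v) g) = qform v *s g"
    and "x \<in> clifford_ideal"
  shows "tensor_action T x f = 0"
  using \<open>x \<in> clifford_ideal\<close>
proof induction
  case (generator x v y)
  then show ?case
    using module_hom.zero[OF module_hom_tensor_action[of T, OF T]]
    by (simp add: tensor_action_mult[OF T] tensor_action_diff tensor_action_scalar square)
next
  case (add x y)
  then show ?case
    by (simp add: tensor_action_add)
qed

section \<open>The Clifford action on the exterior algebra\<close>

text \<open>In characteristic two no signs occur, and the exterior algebra is the free module on the
  finite sets of basis indices: the coordinate at \<open>S\<close> belongs to the wedge product of the basis
  vectors indexed by \<open>S\<close>. The operators are multiplication by a vector \<open>x\<close> and contraction with a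
  covector \<open>y\<close>.\<close>

definition ext_mult :: "laurent ^ 'b::finite \<Rightarrow> laurent ^ 'b set \<Rightarrow> laurent ^ 'b set" where
  "ext_mult x f = (\<chi> S. \<Sum>a\<in>S. x $ a * f $ (S - {a}))"

definition ext_contract :: "laurent ^ 'b::finite \<Rightarrow> laurent ^ 'b set \<Rightarrow> laurent ^ 'b set" where
  "ext_contract y f = (\<chi> S. \<Sum>b\<in>- S. y $ b * f $ insert b S)"

lemma sum_symmetric_pairs:
  fixes g :: "'b \<Rightarrow> 'b \<Rightarrow> laurent"
  assumes "finite S" and sym: "\<And>a b. g a b = g b a"
  shows "(\<Sum>a\<in>S. \<Sum>b\<in>S - {a}. g a b) = 0"
  using \<open>finite S\<close>
proof induction
  case (insert c S)
  have "(\<Sum>b\<in>insert c S - {a}. g a b) = g a c + (\<Sum>b\<in>S - {a}. g a b)" if "a \<in> S" for a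
  proof -
    have "insert c S - {a} = insert c (S - {a})"
      using insert that by auto
    then show ?thesis
      using insert by simp
  qed
  moreover have "insert c S - {c} = S"
    using insert by auto
  moreover have "(\<Sum>b\<in>S. g c b) = (\<Sum>a\<in>S. g a c)"
    by (rule sum.cong) (simp_all add: sym)
  ultimately show ?case
    using insert by (simp add: sum.distrib laurent_double flip: add.assoc)
qed simp

text \<open>The square of either operator sums over ordered pairs of distinct indices, and the two
  orderings of a pair contribute equally.\<close>

lemma ext_mult_square: "ext_mult x (ext_mult x f) = 0"
proof -
  have "(\<Sum>a\<in>S. \<Sum>b\<in>S - {a}. x $ a * (x $ b * f $ (S - {a} - {b}))) = 0" for S
    by (rule sum_symmetric_pairs) (simp_all add: mult_ac Diff_insert2[symmetric] insert_commute)
  then show ?thesis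
    by (simp add: vec_eq_iff ext_mult_def sum_distrib_left)
qed

lemma ext_contract_square: "ext_contract y (ext_contract y f) = 0"
proof -
  have Compl: "- insert a S = - S - {a}" for a S
    by auto
  have "(\<Sum>a\<in>- S. \<Sum>b\<in>- insert a S. y $ a * (y $ b * f $ insert b (insert a S))) = 0" for S
    unfolding Compl by (rule sum_symmetric_pairs) (simp_all add: mult_ac insert_commute)
  then show ?thesis
    by (simp add: vec_eq_iff ext_contract_def sum_distrib_left)
qed

text \<open>The terms that add one index and remove a different one appear in both products and cancel.
  The remaining terms add and remove the same index \<open>a\<close>: the first product has one for each
  \<open>a \<in> S\<close>, the second one for each \<open>a \<notin> S\<close>.\<close>

lemma ext_mult_contract:
  "ext_mult x (ext_contract y f) + ext_contract y (ext_mult x f) = (\<Sum>a\<in>UNIV. x $ a * y $ a) *s f"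
proof -
  have "(\<Sum>a\<in>S. x $ a * (\<Sum>b\<in>- (S - {a}). y $ b * f $ insert b (S - {a})))
      + (\<Sum>b\<in>- S. y $ b * (\<Sum>a\<in>insert b S. x $ a * f $ (insert b S - {a})))
      = (\<Sum>a\<in>UNIV. x $ a * y $ a) * f $ S" for S
  proof -
    define c where "c = (\<Sum>a\<in>S. \<Sum>b\<in>- S. x $ a * y $ b * f $ (insert b S - {a}))"
    have "x $ a * (\<Sum>b\<in>- (S - {a}). y $ b * f $ insert b (S - {a}))
        = x $ a * y $ a * f $ S + (\<Sum>b\<in>- S. x $ a * y $ b * f $ (insert b S - {a}))"
      if "a \<in> S" for a
    proof -
      have "- (S - {a}) = insert a (- S)" "insert a (S - {a}) = S"
        using that by auto
      moreover have "insert b (S - {a}) = insert b S - {a}" if "b \<in> - S" for b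
        using that \<open>a \<in> S\<close> by auto
      ultimately show ?thesis
        using that by (simp add: distrib_left sum_distrib_left mult.assoc)
    qed
    then have 1: "(\<Sum>a\<in>S. x $ a * (\<Sum>b\<in>- (S - {a}). y $ b * f $ insert b (S - {a})))
        = (\<Sum>a\<in>S. x $ a * y $ a * f $ S) + c"
      by (simp add: sum.distrib c_def)
    have "y $ b * (\<Sum>a\<in>insert b S. x $ a * f $ (insert b S - {a}))
        = x $ b * y $ b * f $ S + (\<Sum>a\<in>S. x $ a * y $ b * f $ (insert b S - {a}))"
      if "b \<in> - S" for b
      using that by (simp add: distrib_left sum_distrib_left mult_ac)
    then have "(\<Sum>b\<in>- S. y $ b * (\<Sum>a\<in>insert b S. x $ a * f $ (insert b S - {a})))
        = (\<Sum>b\<in>- S. x $ b * y $ b * f $ S)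
          + (\<Sum>b\<in>- S. \<Sum>a\<in>S. x $ a * y $ b * f $ (insert b S - {a}))"
      by (simp add: sum.distrib)
    also have "\<dots> = (\<Sum>b\<in>- S. x $ b * y $ b * f $ S) + c"
      unfolding c_def by (subst sum.swap) simp
    finally have 2: "(\<Sum>b\<in>- S. y $ b * (\<Sum>a\<in>insert b S. x $ a * f $ (insert b S - {a})))
        = (\<Sum>b\<in>- S. x $ b * y $ b * f $ S) + c" .
    have "(\<Sum>a\<in>UNIV. x $ a * y $ a) * f $ S
        = (\<Sum>a\<in>S. x $ a * y $ a * f $ S) + (\<Sum>b\<in>- S. x $ b * y $ b * f $ S)"
      using sum.union_disjoint[of S "- S" "\<lambda>a. x $ a * y $ a * f $ S"]
      by (simp add: sum_distrib_right)
    then show ?thesis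
      using laurent_double[of c] unfolding 1 2 by (simp add: algebra_simps)
  qed
  then show ?thesis
    by (simp add: vec_eq_iff ext_mult_def ext_contract_def)
qed

lemma ext_mult_add_right: "ext_mult x (f + g) = ext_mult x f + ext_mult x g"
  by (simp add: ext_mult_def vec_eq_iff distrib_left sum.distrib)

lemma ext_mult_scale_right: "ext_mult x (r *s f) = r *s ext_mult x f"
  by (simp add: ext_mult_def vec_eq_iff sum_distrib_left mult_ac)

lemma ext_contract_add_right: "ext_contract x (f + g) = ext_contract x f + ext_contract x g"
  by (simp add: ext_contract_def vec_eq_iff distrib_left sum.distrib)

lemma ext_contract_scale_right: "ext_contract x (r *s f) = r *s ext_contract x f"
  by (simp add: ext_contract_def vec_eq_iff sum_distrib_left mult_ac)

text \<open>Chevalley's construction: a bilinear form \<open>\<beta>\<close>, not necessarily symmetric, turns \<open>x\<close> into the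
  covector \<open>\<beta>(x, \<cdot>)\<close>; wedging with \<open>x\<close> plus contracting with this covector has square
  \<open>\<beta>(x, x)\<close>.\<close>

definition clifford_action :: "('b \<Rightarrow> 'b \<Rightarrow> laurent) \<Rightarrow> laurent ^ 'b::finite \<Rightarrow>
    laurent ^ 'b set \<Rightarrow> laurent ^ 'b set" where
  "clifford_action \<beta> x f = ext_mult x f + ext_contract (\<chi> b. \<Sum>a\<in>UNIV. x $ a * \<beta> a b) f"

lemma clifford_action_square:
  "clifford_action \<beta> x (clifford_action \<beta> x f) = (\<Sum>a\<in>UNIV. \<Sum>b\<in>UNIV. x $ a * x $ b * \<beta> a b) *s f"
proof -
  let ?y = "\<chi> b. \<Sum>a\<in>UNIV. x $ a * \<beta> a b"
  have "clifford_action \<beta> x (clifford_action \<beta> x f)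
      = ext_mult x (ext_contract ?y f) + ext_contract ?y (ext_mult x f)"
    by (simp add: clifford_action_def ext_mult_add_right ext_contract_add_right
        ext_mult_square ext_contract_square)
  also have "\<dots> = (\<Sum>b\<in>UNIV. \<Sum>a\<in>UNIV. x $ a * x $ b * \<beta> a b) *s f"
    by (simp add: ext_mult_contract sum_distrib_left mult_ac)
  also have "\<dots> = (\<Sum>a\<in>UNIV. \<Sum>b\<in>UNIV. x $ a * x $ b * \<beta> a b) *s f"
    by (subst sum.swap) simp
  finally show ?thesis .
qed

lemma module_hom_clifford_action: "module_hom (*s) (*s) (clifford_action \<beta> x)"
  by (simp add: module_hom_iff module_vec clifford_action_def ext_mult_add_right ext_contract_add_right
      ext_mult_scale_right ext_contract_scale_right vector_add_ldistrib add_ac)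

lemma clifford_action_axis_sum:
  "(\<Sum>c\<in>UNIV. x $ c *s clifford_action \<beta> (axis c 1) f) = clifford_action \<beta> x f"
proof -
  have "(\<Sum>c\<in>UNIV. x $ c * (\<Sum>a\<in>S. axis c 1 $ a * f $ (S - {a}))) = (\<Sum>a\<in>S. x $ a * f $ (S - {a}))" for S
  proof -
    have "(\<Sum>c\<in>UNIV. x $ c * (\<Sum>a\<in>S. axis c 1 $ a * f $ (S - {a})))
        = (\<Sum>a\<in>S. \<Sum>c\<in>UNIV. if c = a then x $ a * f $ (S - {a}) else 0)"
      unfolding sum_distrib_left by (subst sum.swap) (intro sum.cong refl, simp add: axis_def)
    then show ?thesis
      by simp
  qed
  moreover have "(\<Sum>a\<in>UNIV. axis c 1 $ a * \<beta> a b) = \<beta> c b" for b c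
  proof -
    have "(\<Sum>a\<in>UNIV. axis c 1 $ a * \<beta> a b) = (\<Sum>a\<in>UNIV. if a = c then \<beta> a b else 0)"
      by (rule sum.cong) (auto simp: axis_def)
    then show ?thesis
      by simp
  qed
  moreover have "(\<Sum>c\<in>UNIV. x $ c * (\<Sum>b\<in>- S. \<beta> c b * f $ insert b S))
      = (\<Sum>b\<in>- S. (\<Sum>a\<in>UNIV. x $ a * \<beta> a b) * f $ insert b S)" for S
    unfolding sum_distrib_left sum_distrib_right by (subst sum.swap) (simp add: mult_ac)
  ultimately show ?thesis
    by (simp add: vec_eq_iff clifford_action_def ext_mult_def ext_contract_def distrib_left sum.distrib)
qed

text \<open>In characteristic two \<open>q(x) = \<beta>(x, x)\<close> has no symmetric solution \<open>\<beta>\<close>, as the polarization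
  \<open>\<beta>(x, y) + \<beta>(y, x)\<close> would then vanish. It suffices to put each coefficient 1 of the bilinear form on
  one of the two orderings of the pair, which is what the hypotheses provide for.\<close>

lemma qform_eq_tournament:
  fixes \<beta> :: "'m::finite option \<Rightarrow> 'm option \<Rightarrow> laurent"
  assumes diag: "\<And>a. \<beta> a a = qdiag a" and tournament: "\<And>a b. a \<noteq> b \<Longrightarrow> \<beta> a b + \<beta> b a = 1"
  shows "(\<Sum>a\<in>UNIV. \<Sum>b\<in>UNIV. x $ a * x $ b * \<beta> a b) = qform x"
proof -
  define B where "B x y = (\<Sum>a\<in>UNIV. \<Sum>b\<in>UNIV. x $ a * y $ b * \<beta> a b)" for x y :: "'m V"
  have axis: "B (axis c 1) (axis c 1) = qdiag c" for c
  proof -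
    have "B (axis c 1) (axis c 1) = (\<Sum>a\<in>UNIV. \<Sum>b\<in>UNIV. if b = c then if a = c then \<beta> a b else 0 else 0)"
      unfolding B_def by (intro sum.cong refl) (simp add: axis_def)
    then show ?thesis
      by (simp add: diag)
  qed
  have "(\<lambda>x. B x x) = qform"
  proof (rule qform_unique)
    show "B (r *s x) (r *s x) = r\<^sup>2 * B x x" for r x
      by (simp add: B_def sum_distrib_left power2_eq_square mult_ac)
    show "B (x + y) (x + y) = B x x + B y y + bform x y" for x y
    proof -
      have "B x y + B y x = (\<Sum>a\<in>UNIV. \<Sum>b\<in>UNIV. x $ a * y $ b * (\<beta> a b + \<beta> b a))"
      proof -
        have "B y x = (\<Sum>a\<in>UNIV. \<Sum>b\<in>UNIV. x $ a * y $ b * \<beta> b a)"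
          unfolding B_def by (subst sum.swap) (simp add: mult_ac)
        then show ?thesis
          by (simp add: B_def distrib_left sum.distrib)
      qed
      also have "\<dots> = bform x y"
        unfolding bform_def
      proof (rule sum.cong)
        fix a
        have "(\<Sum>b\<in>UNIV. x $ a * y $ b * (\<beta> a b + \<beta> b a))
            = (\<Sum>b\<in>UNIV - {a}. x $ a * y $ b * (\<beta> a b + \<beta> b a))"
          by (rule sum.mono_neutral_right) (auto simp: laurent_double)
        then show "(\<Sum>b\<in>UNIV. x $ a * y $ b * (\<beta> a b + \<beta> b a)) = (\<Sum>b\<in>UNIV - {a}. x $ a * y $ b)"
          by (simp add: tournament)
      qed simp
      finally show ?thesis
        by (simp add: B_def algebra_simps sum.distrib)
    qed
    show "B u_vec u_vec = 1" "B (v_vec i) (v_vec i) = t_pow (- 1)" for i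
      by (simp_all add: u_vec_def v_vec_def axis qdiag_def)
  qed
  then show ?thesis
    by (metis B_def)
qed

text \<open>Scalars act on the exterior algebra by multiplication, so distinct scalars remain distinct in
  the quotient.\<close>

lemma inj_cl_scalar: "inj (cl_scalar :: laurent \<Rightarrow> 'm::finite clifford)"
proof (rule injI)
  fix r s
  assume eq: "(cl_scalar r :: 'm clifford) = cl_scalar s"
  obtain idx :: "'m option \<Rightarrow> nat" where idx: "inj idx"
    using finite_imp_inj_to_nat_seg[of "UNIV :: 'm option set"] by auto
  \<comment> \<open>Any linear order of the basis decides which ordering of a pair carries the coefficient 1.\<close>
  define \<beta> where "\<beta> a b = (if a = b then qdiag a else if idx a < idx b then 1 else 0)" for a b
  define T where "T a = clifford_action \<beta> (axis a 1)" for a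
  have T: "module_hom (*s) (*s) (T b)" for b
    by (simp add: T_def module_hom_clifford_action)
  have "\<beta> a b + \<beta> b a = 1" if "a \<noteq> b" for a b
    using that injD[OF idx, of a b] by (auto simp: \<beta>_def)
  then have "clifford_action \<beta> v (clifford_action \<beta> v g) = qform v *s g" for v g
    by (simp add: clifford_action_square qform_eq_tournament \<beta>_def)
  then have square: "tensor_action T (tensor_vec v) (tensor_action T (tensor_vec v) g) = qform v *s g" for v g
    by (simp add: tensor_action_vec T_def clifford_action_axis_sum)
  have "(tensor_scalar r - tensor_scalar s :: 'm tensor) \<in> clifford_ideal"
    using eq by transfer
  then have "tensor_action T (tensor_scalar r - tensor_scalar s) 1 = 0"
    by (rule tensor_action_clifford_ideal[OF T square])
  then show "r = s"
    by (simp add: tensor_action_diff tensor_action_scalar vec_eq_iff)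
qed

section \<open>Scalars and vectors in the Clifford algebra\<close>

lemma cl_scalar_add: "cl_scalar (r + s) = cl_scalar r + cl_scalar s"
  by transfer (simp add: tensor_scalar_def single_add clifford_ideal_zero)

lemma cl_scalar_mult: "cl_scalar (r * s) = cl_scalar r * cl_scalar s"
  by transfer (simp add: tensor_scalar_def mult_single clifford_ideal_zero)

lemma cl_scalar_one: "cl_scalar 1 = 1"
  by transfer (simp add: tensor_scalar_def clifford_ideal_zero)

lemma cl_scalar_zero: "cl_scalar 0 = 0"
  by transfer (simp add: tensor_scalar_def clifford_ideal_zero)

lemma tensor_scalar_commute: "tensor_scalar r * x = x * tensor_scalar r"
  by (induction x rule: tensor_induct)
    (simp_all add: tensor_scalar_def mult_single mult.commute distrib_left distrib_right)

lemma cl_scalar_commute: "cl_scalar r * x = x * cl_scalar r"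
  by transfer (simp add: tensor_scalar_commute clifford_ideal_zero)

lemma cl_vec_add: "cl_vec (x + y) = cl_vec x + cl_vec y"
  by transfer (simp add: tensor_vec_def single_add sum.distrib clifford_ideal_zero)

lemma cl_vec_scale: "cl_vec (r *s x) = cl_scalar r * cl_vec x"
  by transfer (simp add: tensor_vec_def tensor_scalar_def sum_distrib_left mult_single clifford_ideal_zero)

lemma clifford_double: "x + x = 0" for x :: "'m::finite clifford"
proof -
  have "x + x = (cl_scalar 1 + cl_scalar 1) * x"
    by (simp add: cl_scalar_one distrib_right)
  also have "\<dots> = 0"
    by (simp add: laurent_double cl_scalar_zero flip: cl_scalar_add)
  finally show ?thesis .
qed

lemma clifford_add_eq_0_iff: "x + y = 0 \<longleftrightarrow> x = y" for x y :: "'m::finite clifford"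
  by (metis add_right_cancel clifford_double)

text \<open>Polarization of \<open>w\<^sup>2 = q(w)\<close>.\<close>

lemma cl_vec_anticommute: "cl_vec x * cl_vec y + cl_vec y * cl_vec x = cl_scalar (bform x y)"
proof -
  have "cl_scalar (qform (x + y)) = cl_vec (x + y) * cl_vec (x + y)"
    by (simp add: cl_vec_square)
  also have "\<dots> = cl_scalar (qform x + qform y) + (cl_vec x * cl_vec y + cl_vec y * cl_vec x)"
    by (simp add: cl_vec_add distrib_left distrib_right cl_vec_square cl_scalar_add add_ac)
  finally show ?thesis
    by (simp add: qform_add cl_scalar_add)
qed

lemma cl_induct [case_names scalar add vec]:
  fixes x :: "'m::finite clifford"
  assumes scalar: "\<And>r. P (cl_scalar r)"
    and add: "\<And>x y. P x \<Longrightarrow> P y \<Longrightarrow> P (x + y)"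
    and vec: "\<And>b x. P x \<Longrightarrow> P (cl_vec (axis b 1) * x)"
  shows "P x"
proof -
  have word: "P (clifford_of (Poly_Mapping.single (FW bs) r))" for bs r
  proof (induction bs)
    case Nil
    show ?case
      using scalar[of r] by (simp add: cl_scalar.abs_eq tensor_scalar_def zero_free_word_def)
  next
    case (Cons b bs)
    have "tensor_vec (axis b 1 :: 'm V) = (\<Sum>c\<in>UNIV. if c = b then Poly_Mapping.single (FW [b]) 1 else 0)"
      unfolding tensor_vec_def by (rule sum.cong) (auto simp: axis_def)
    then have "tensor_vec (axis b 1 :: 'm V) * Poly_Mapping.single (FW bs) r
        = Poly_Mapping.single (FW (b # bs)) r"
      by (simp add: mult_single plus_free_word_def)
    then show ?case
      using vec[OF Cons, of b] by (simp add: cl_vec.abs_eq times_clifford.abs_eq)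
  qed
  have "P (clifford_of z)" for z
  proof (induction z rule: tensor_induct)
    case (single w r)
    show ?case
      using word[of "letters w" r] by simp
  next
    case (add y z)
    then show ?case
      using assms(2) by (simp flip: plus_clifford.abs_eq)
  qed
  then show ?thesis
    by (induction x rule: clifford.abs_induct)
qed

section \<open>The dual basis\<close>

definition dual_vec :: "'m option \<Rightarrow> 'm::finite V" where
  "dual_vec a = (\<chi> b. if b = a then 0 else 1)"

text \<open>The pairing of \<open>e\<^sub>c\<close> with the sum of all \<open>e\<^sub>b\<close>, \<open>b \<noteq> a\<close>, counts the \<open>b\<close> different from both
  \<open>a\<close> and \<open>c\<close>. There are \<open>m\<close> of them if \<open>a = c\<close> and \<open>m - 1\<close> otherwise; for odd \<open>m\<close> the
  parities are those of the Kronecker delta.\<close>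

lemma bform_dual_vec:
  assumes "odd CARD('m::finite)"
  shows "bform (x :: 'm V) (dual_vec a) = x $ a"
proof -
  have of_nat: "of_nat k = (if even k then 0 else 1 :: laurent)" for k
    by (induction k) (auto simp: laurent_double)
  have "(\<Sum>b\<in>UNIV - {c}. dual_vec a $ b) = (if c = a then 1 else 0)" for c :: "'m option"
  proof -
    have "(\<Sum>b\<in>UNIV - {c}. dual_vec a $ b) = (\<Sum>b\<in>UNIV - {c, a}. 1)"
      by (rule sum.mono_neutral_cong_right) (auto simp: dual_vec_def)
    also have "\<dots> = of_nat (card (UNIV - {c, a}))"
      by simp
    also have "card (UNIV - {c, a}) = CARD('m option) - card {c, a}"
      by (rule card_Diff_subset) auto
    also have "of_nat \<dots> = (if c = a then 1 else 0 :: laurent)"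
      using assms by (cases "CARD('m)") (auto simp: of_nat)
    finally show ?thesis .
  qed
  then have "bform x (dual_vec a) = (\<Sum>c\<in>UNIV. if c = a then x $ c else 0)"
    unfolding bform_def by (intro sum.cong) (simp_all flip: sum_distrib_left)
  then show ?thesis
    by simp
qed

lemma bform_nondegenerate:
  assumes "odd CARD('m::finite)" "\<And>y. bform (x :: 'm V) y = 0"
  shows "x = 0"
  using assms bform_dual_vec[OF assms(1), of x] by (simp add: vec_eq_iff)

text \<open>A vector that is a scalar commutes with all vectors, hence is orthogonal to \<open>V\<close>.\<close>

lemma cl_vec_in_scalars:
  assumes "odd CARD('m::finite)" "cl_vec (x :: 'm V) = cl_scalar r"
  shows "x = 0"
proof (rule bform_nondegenerate[OF assms(1)])
  fix y
  have "(cl_scalar (bform x y) :: 'm clifford) = cl_scalar r * cl_vec y + cl_vec y * cl_scalar r"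
    by (simp add: assms(2) flip: cl_vec_anticommute)
  also have "\<dots> = cl_scalar 0"
    by (simp add: cl_scalar_commute clifford_double cl_scalar_zero)
  finally show "bform x y = 0"
    by (rule injD[OF inj_cl_scalar])
qed

lemma inj_cl_vec:
  assumes "odd CARD('m::finite)"
  shows "inj (cl_vec :: 'm V \<Rightarrow> 'm clifford)"
proof (rule injI)
  fix x y :: "'m V"
  assume eq: "cl_vec x = cl_vec y"
  have "y + y = 0"
    by (simp only: vec_eq_iff vector_add_component laurent_double zero_index simp_thms)
  moreover have "cl_vec (x + y) = cl_scalar 0"
    by (simp add: cl_vec_add eq clifford_double cl_scalar_zero)
  then have "x + y = 0"
    by (rule cl_vec_in_scalars[OF assms])
  ultimately show "x = y"
    by (metis add_right_cancel)
qed

section \<open>The centre of the Clifford algebra\<close>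

text \<open>The subalgebra generated by the basis vectors with indices in \<open>A\<close>, built up by left
  multiplication with generators.\<close>

inductive_set cl_subalgebra :: "'m::finite option set \<Rightarrow> 'm clifford set" for A where
  scalar: "cl_scalar r \<in> cl_subalgebra A"
| add: "x \<in> cl_subalgebra A \<Longrightarrow> y \<in> cl_subalgebra A \<Longrightarrow> x + y \<in> cl_subalgebra A"
| vec: "b \<in> A \<Longrightarrow> x \<in> cl_subalgebra A \<Longrightarrow> cl_vec (axis b 1) * x \<in> cl_subalgebra A"

lemma cl_subalgebra_UNIV: "x \<in> cl_subalgebra UNIV"
  by (induction x rule: cl_induct) (simp_all add: cl_subalgebra.intros)

lemma cl_subalgebra_scale: "x \<in> cl_subalgebra A \<Longrightarrow> cl_scalar r * x \<in> cl_subalgebra A"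
proof (induction rule: cl_subalgebra.induct)
  case (scalar s)
  show ?case
    using cl_subalgebra.scalar[of "r * s"] by (simp add: cl_scalar_mult)
next
  case (add x y)
  then show ?case
    by (simp add: distrib_left cl_subalgebra.add)
next
  case (vec b x)
  have "cl_scalar r * (cl_vec (axis b 1) * x) = cl_vec (axis b 1) * (cl_scalar r * x)"
    by (metis cl_scalar_commute mult.assoc)
  with vec show ?case
    by (simp add: cl_subalgebra.vec)
qed

text \<open>The right-hand sides are closed under left multiplication by the generators: \<open>e\<^sub>b\<close> moves past
  \<open>e\<^sub>c\<close> at the cost of a scalar, and \<open>e\<^sub>c\<^sup>2\<close> is a scalar. So one factor \<open>e\<^sub>c\<close> on the left is
  enough.\<close>

lemma cl_subalgebra_insert:
  assumes "x \<in> cl_subalgebra (insert c A)"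
  shows "\<exists>y\<in>cl_subalgebra A. \<exists>z\<in>cl_subalgebra A. x = y + cl_vec (axis c 1) * z"
  using assms
proof induction
  case (scalar r)
  have "cl_scalar r = cl_scalar r + cl_vec (axis c 1) * cl_scalar 0"
    by (simp add: cl_scalar_zero)
  then show ?case
    using cl_subalgebra.scalar by blast
next
  case (add x x')
  then obtain y z y' z' where "x = y + cl_vec (axis c 1) * z" "x' = y' + cl_vec (axis c 1) * z'"
    and "y + y' \<in> cl_subalgebra A" "z + z' \<in> cl_subalgebra A"
    by (meson cl_subalgebra.add)
  moreover from this have "x + x' = (y + y') + cl_vec (axis c 1) * (z + z')"
    by (simp add: distrib_left add_ac)
  ultimately show ?case
    by blast
next
  case (vec b x)
  then obtain y z where yz: "y \<in> cl_subalgebra A" "z \<in> cl_subalgebra A"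
    and x: "x = y + cl_vec (axis c 1) * z"
    by blast
  let ?b = "cl_vec (axis b 1)" and ?c = "cl_vec (axis c 1)"
  show ?case
  proof (cases "b = c")
    case True
    have "?b * x = cl_scalar (qform (axis c 1)) * z + ?c * y"
      by (simp add: x True distrib_left add.commute flip: mult.assoc cl_vec_square)
    then show ?thesis
      using yz cl_subalgebra_scale by blast
  next
    case False
    have "?b * ?c + ?c * ?b = 1"
      using False by (simp add: cl_vec_anticommute bform_axis cl_scalar_one)
    then have "?b * ?c = 1 + ?c * ?b"
      by (metis add.assoc add.right_neutral clifford_double)
    then have "?b * x = (?b * y + z) + ?c * (?b * z)"
      by (simp add: x distrib_left distrib_right add.assoc flip: mult.assoc)
    moreover have "b \<in> A"
      using vec False by simp
    ultimately show ?thesis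
      using yz cl_subalgebra.intros by blast
  qed
qed

text \<open>In characteristic two this sum is a commutator, so it is a derivation. For odd \<open>m\<close> it is
  the partial derivative in the direction of the basis vector with index \<open>b\<close>.\<close>

definition cl_deriv :: "'m option \<Rightarrow> 'm::finite clifford \<Rightarrow> 'm clifford" where
  "cl_deriv b x = x * cl_vec (dual_vec b) + cl_vec (dual_vec b) * x"

lemma cl_deriv_add: "cl_deriv b (x + y) = cl_deriv b x + cl_deriv b y"
  by (simp add: cl_deriv_def distrib_left distrib_right add_ac)

lemma cl_deriv_scalar: "cl_deriv b (cl_scalar r) = 0"
  by (simp add: cl_deriv_def cl_scalar_commute clifford_double)

lemma cl_deriv_vec:
  assumes "odd CARD('m::finite)"
  shows "cl_deriv b (cl_vec (axis c 1) * x :: 'm clifford)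
    = (if b = c then x else 0) + cl_vec (axis c 1) * cl_deriv b x"
proof -
  let ?c = "cl_vec (axis c 1) :: 'm clifford" and ?d = "cl_vec (dual_vec b)"
  have cd: "?c * ?d + ?d * ?c = (if b = c then 1 else 0)"
    by (simp add: cl_vec_anticommute bform_dual_vec[OF assms] axis_def cl_scalar_one cl_scalar_zero)
  have "cl_deriv b (?c * x) = (?c * ?d + ?d * ?c) * x + ?c * cl_deriv b x"
  proof -
    have "(?c * ?d + ?d * ?c) * x + ?c * cl_deriv b x
      = cl_deriv b (?c * x) + (?c * ?d * x + ?c * ?d * x)"
      by (simp add: cl_deriv_def distrib_left distrib_right mult.assoc add_ac)
    then show ?thesis
      by (simp add: clifford_double)
  qed
  then show ?thesis
    by (simp add: cd)
qed

lemma cl_deriv_cl_subalgebra: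
  assumes "odd CARD('m::finite)" "x \<in> cl_subalgebra A" "b \<notin> A"
  shows "cl_deriv b (x :: 'm clifford) = 0"
  using assms(2)
  by induction (use assms in \<open>auto simp: cl_deriv_scalar cl_deriv_add cl_deriv_vec\<close>)

text \<open>Writing \<open>x = y + e\<^sub>c z\<close> with \<open>y\<close>, \<open>z\<close> free of \<open>e\<^sub>c\<close>, the derivative in direction \<open>e\<^sub>c\<close> is \<open>z\<close>. If it
  vanishes, then \<open>x = y\<close> and the generator \<open>e\<^sub>c\<close> has been eliminated.\<close>

lemma cl_constants_scalar:
  assumes "odd CARD('m::finite)" "finite A" "(x :: 'm clifford) \<in> cl_subalgebra A"
    and "\<And>b. b \<in> A \<Longrightarrow> cl_deriv b x = 0"
  shows "x \<in> range cl_scalar"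
  using assms(2-)
proof (induction A)
  case empty
  from empty(1) show ?case
    by induction (auto simp flip: cl_scalar_add)
next
  case (insert c A)
  then obtain y z where yz: "y \<in> cl_subalgebra A" "z \<in> cl_subalgebra A"
    and x: "x = y + cl_vec (axis c 1) * z"
    using cl_subalgebra_insert by blast
  have "cl_deriv c x = z"
    using insert(2) yz by (simp add: x cl_deriv_add cl_deriv_vec[OF assms(1)]
        cl_deriv_cl_subalgebra[OF assms(1)])
  then have "x = y"
    using insert(5)[of c] x by simp
  then show ?case
    using insert yz by blast
qed

lemma centralizer_of_dual_basis:
  assumes "odd CARD('m::finite)"
    and "\<And>b. (x :: 'm clifford) * cl_vec (dual_vec b) = cl_vec (dual_vec b) * x"
  shows "x \<in> range cl_scalar"
  by (rule cl_constants_scalar[OF assms(1) finite cl_subalgebra_UNIV])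
    (simp add: cl_deriv_def assms(2) clifford_double)

section \<open>The Clifford group and the orthogonal group\<close>

lemma cl_inv:
  assumes "c \<in> cl_units"
  shows "c * cl_inv c = 1" "cl_inv c * c = 1"
proof -
  obtain d where d: "c * d = 1 \<and> d * c = 1"
    using assms by (auto simp: cl_units_def)
  moreover have "e = d" if "c * e = 1 \<and> e * c = 1" for e
    using that d by (metis mult.assoc mult_1_left mult_1_right)
  ultimately have "c * cl_inv c = 1 \<and> cl_inv c * c = 1"
    unfolding cl_inv_def by (rule theI)
  then show "c * cl_inv c = 1" "cl_inv c * c = 1"
    by auto
qed

lemma cl_vec_intertwine:
  assumes "c \<in> clifford_group"
  shows "c * cl_vec (clifford_pi c x) = cl_vec x * c"
  using assms cl_inv(1)[of c]
  by (simp add: cl_vec_clifford_pi clifford_group_def flip: mult.assoc)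

text \<open>The form in which linearity is checked: it avoids the inverse of \<open>c\<close> and the choice of a
  preimage under \<^const>\<open>cl_vec\<close>.\<close>

lemma clifford_pi_eqI:
  assumes "odd CARD('m::finite)" "c \<in> clifford_group" "c * cl_vec y = cl_vec x * c"
  shows "clifford_pi c x = (y :: 'm V)"
proof (rule injD[OF inj_cl_vec[OF assms(1)]])
  have "cl_inv c * (c * cl_vec (clifford_pi c x)) = cl_inv c * (c * cl_vec y)"
    using assms cl_vec_intertwine by metis
  then show "cl_vec (clifford_pi c x) = cl_vec y"
    using assms(2) cl_inv(2)[of c] by (simp add: clifford_group_def flip: mult.assoc)
qed

lemma clifford_pi_module_hom:
  assumes "odd CARD('m::finite)" "c \<in> clifford_group"
  shows "module_hom (*s) (*s) (clifford_pi c :: 'm V \<Rightarrow> 'm V)"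
proof -
  have "clifford_pi c (x + y) = clifford_pi c x + clifford_pi c y" for x y
    by (rule clifford_pi_eqI[OF assms])
      (simp add: cl_vec_add distrib_left distrib_right cl_vec_intertwine[OF assms(2)])
  moreover have "clifford_pi c (r *s x) = r *s clifford_pi c x" for r x
  proof (rule clifford_pi_eqI[OF assms])
    have "c * (cl_scalar r * cl_vec (clifford_pi c x)) = cl_scalar r * (c * cl_vec (clifford_pi c x))"
      by (simp only: cl_scalar_commute[of r] mult.assoc)
    then show "c * cl_vec (r *s clifford_pi c x) = cl_vec (r *s x) * c"
      by (simp add: cl_vec_scale cl_vec_intertwine[OF assms(2)] mult.assoc)
  qed
  ultimately show ?thesis
    by (simp add: module_hom_iff module_vec)
qed

lemma qform_clifford_pi:
  assumes "c \<in> clifford_group"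
  shows "qform (clifford_pi c x) = qform (x :: 'm::finite V)"
proof -
  let ?x = "cl_vec (clifford_pi c x)"
  have c: "cl_inv c * c = 1"
    using assms cl_inv(2)[of c] by (simp add: clifford_group_def)
  have "?x * ?x = cl_inv c * (c * ?x * ?x)"
    using c by (simp flip: mult.assoc)
  also have "c * ?x * ?x = cl_vec x * cl_vec x * c"
    by (metis cl_vec_intertwine[OF assms] mult.assoc)
  also have "cl_inv c * \<dots> = cl_scalar (qform x)"
    by (metis c cl_scalar_commute cl_vec_square mult.assoc mult_1_right)
  finally have "(cl_scalar (qform (clifford_pi c x)) :: 'm clifford) = cl_scalar (qform x)"
    by (simp add: cl_vec_square)
  then show ?thesis
    by (rule injD[OF inj_cl_scalar])
qed

lemma bform_clifford_pi:
  assumes "odd CARD('m::finite)" "c \<in> clifford_group"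
  shows "bform (clifford_pi c x) (clifford_pi c y) = bform x (y :: 'm V)"
  using qform_add[of "clifford_pi c x" "clifford_pi c y"] qform_add[of x y]
    module_hom.add[OF clifford_pi_module_hom[OF assms], of x y, symmetric]
  by (simp add: qform_clifford_pi[OF assms(2)])

text \<open>As \<open>z\<close> commutes with the images of the dual basis, \<open>c z c\<inverse>\<close> commutes with the dual basis
  itself. Conjugating \<open>z\<close> back by \<open>c\<close> gives an
  element that is not yet known to be a vector, as the definition of the
  Clifford group only says that \<open>c\<inverse> V c \<subseteq> V\<close>. The centralizer shows that it is a scalar.\<close>

lemma clifford_pi_perp:
  assumes "odd CARD('m::finite)" "c \<in> clifford_group"
    and perp: "\<And>b. bform (z :: 'm V) (clifford_pi c (dual_vec b)) = 0"
  shows "z = 0"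
proof -
  have c: "c * cl_inv c = 1" "cl_inv c * c = 1"
    using assms(2) cl_inv[of c] by (simp_all add: clifford_group_def)
  let ?d = "c * cl_vec z * cl_inv c"
  have "?d * cl_vec (dual_vec b) = cl_vec (dual_vec b) * ?d" for b
  proof -
    let ?x = "dual_vec b"
    let ?y = "cl_vec (clifford_pi c ?x)"
    have commute: "cl_vec z * ?y = ?y * cl_vec z"
      using perp[of b] cl_vec_anticommute[of z "clifford_pi c ?x"]
      by (simp add: cl_scalar_zero clifford_add_eq_0_iff)
    have inv: "cl_inv c * cl_vec ?x = ?y * cl_inv c"
      using c cl_vec_clifford_pi[OF assms(2), of ?x] by (simp add: mult.assoc)
    have "?d * cl_vec ?x = c * (cl_vec z * ?y) * cl_inv c"
      by (simp add: inv mult.assoc)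
    also have "\<dots> = c * ?y * cl_vec z * cl_inv c"
      by (simp add: commute mult.assoc)
    also have "\<dots> = cl_vec ?x * ?d"
      by (simp add: cl_vec_intertwine[OF assms(2)] mult.assoc)
    finally show ?thesis .
  qed
  then obtain r where r: "?d = cl_scalar r"
    using centralizer_of_dual_basis[OF assms(1)] by blast
  have cancel: "cl_inv c * (c * w) = w" for w
    by (simp add: c flip: mult.assoc)
  have "cl_vec z = cl_inv c * ?d * c"
    by (simp add: c cancel mult.assoc)
  also have "\<dots> = cl_scalar r"
    unfolding r by (simp add: cancel cl_scalar_commute[of r c] mult.assoc)
  finally show ?thesis
    by (rule cl_vec_in_scalars[OF assms(1)])
qed

text \<open>Injectivity holds as the form is preserved and nondegenerate. For surjectivity, the vector \<open>x\<close>
  whose coordinates are the pairings of \<open>y\<close> with the images of the dual basis has an image that differs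
  from \<open>y\<close> by a vector orthogonal to these images.\<close>

lemma bij_clifford_pi:
  assumes "odd CARD('m::finite)" "c \<in> clifford_group"
  shows "bij (clifford_pi c :: 'm V \<Rightarrow> 'm V)"
proof (rule bijI)
  let ?f = "clifford_pi c :: 'm V \<Rightarrow> 'm V"
  have bform_diff: "bform (x - y) z = bform x z - bform y z" for x y z :: "'m V"
    by (simp add: bform_def left_diff_distrib sum_subtractf)
  show "inj ?f"
  proof (rule injI)
    fix x y
    assume "?f x = ?f y"
    then have "bform (x - y) z = 0" for z
      using bform_clifford_pi[OF assms, of x z] bform_clifford_pi[OF assms, of y z]
      by (simp add: bform_diff)
    then show "x = y"
      using bform_nondegenerate[OF assms(1)] by fastforce
  qed
  show "surj ?f"
  proof (rule surjI)
    fix y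
    let ?x = "\<chi> a. bform y (?f (dual_vec a))"
    have "bform (?f ?x) (?f (dual_vec a)) = bform y (?f (dual_vec a))" for a
      by (simp add: bform_clifford_pi[OF assms] bform_dual_vec[OF assms(1)])
    then have "?f ?x - y = 0"
      by (intro clifford_pi_perp[OF assms]) (simp add: bform_diff)
    then show "?f ?x = y"
      by simp
  qed
qed

lemma clifford_pi_orthogonal:
  assumes "odd CARD('m::finite)" "c \<in> clifford_group"
  shows "clifford_pi c \<in> (orthogonal_group :: ('m V \<Rightarrow> 'm V) set)"
  using assms by (simp add: orthogonal_group_def clifford_pi_module_hom bij_clifford_pi qform_clifford_pi)

section \<open>Injectivity on the pin group\<close>

lemma clifford_pi_eq_imp_scalar_multiple:
  assumes "odd CARD('m::finite)" "c \<in> clifford_group" "d \<in> clifford_group"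
    and eq: "clifford_pi c = (clifford_pi d :: 'm V \<Rightarrow> 'm V)"
  obtains r where "c = cl_scalar r * d"
proof -
  have d: "d * cl_inv d = 1" "cl_inv d * d = 1"
    using assms(3) cl_inv[of d] by (simp_all add: clifford_group_def)
  have "c * cl_inv d * cl_vec x = cl_vec x * (c * cl_inv d)" for x
  proof -
    have "cl_inv d * cl_vec x = cl_vec (clifford_pi c x) * cl_inv d"
      using d cl_vec_clifford_pi[OF assms(3), of x] by (simp add: eq mult.assoc)
    then have "c * cl_inv d * cl_vec x = c * cl_vec (clifford_pi c x) * cl_inv d"
      by (simp add: mult.assoc)
    then show ?thesis
      by (simp add: cl_vec_intertwine[OF assms(2)] mult.assoc)
  qed
  then obtain r where "c * cl_inv d = cl_scalar r"
    using centralizer_of_dual_basis[OF assms(1)] by blast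
  moreover have "c = c * cl_inv d * d"
    by (simp add: d mult.assoc)
  ultimately have "c = cl_scalar r * d"
    by simp
  then show thesis
    by (rule that)
qed

text \<open>In characteristic two \<open>r\<^sup>2 - 1 = (r - 1)\<^sup>2\<close>.\<close>

lemma laurent_square_eq_1: "r = 1" if "r\<^sup>2 = 1" for r :: laurent
proof -
  have "(r - 1)\<^sup>2 = r\<^sup>2 + 1 - (r + r)"
    by (simp add: power2_eq_square algebra_simps)
  then have "(r - 1)\<^sup>2 = 0"
    using laurent_double[of 1] by (simp only: that laurent_double diff_0_right)
  then show ?thesis
    by simp
qed

lemma cl_conj_scale: "cl_conj (cl_scalar r * x) = cl_scalar r * cl_conj x"
  by transfer (simp add: tensor_transpose_mult tensor_transpose_scalar tensor_scalar_commute clifford_ideal_zero)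

lemma inj_on_clifford_pi_pin:
  assumes "odd CARD('m::finite)"
  shows "inj_on clifford_pi (pin_group :: 'm clifford set)"
proof (rule inj_onI)
  fix c d :: "'m clifford"
  assume pin: "c \<in> pin_group" "d \<in> pin_group" and eq: "clifford_pi c = clifford_pi d"
  then obtain r where r: "c = cl_scalar r * d"
    using clifford_pi_eq_imp_scalar_multiple[OF assms] by (auto simp: pin_group_def)
  have "cl_scalar (r\<^sup>2) = cl_scalar r * cl_scalar r * (d * cl_conj d)"
    using pin by (simp add: pin_group_def power2_eq_square cl_scalar_mult)
  also have "\<dots> = c * cl_conj c"
    unfolding r cl_conj_scale by (metis cl_scalar_commute mult.assoc)
  also have "\<dots> = cl_scalar 1"
    using pin by (simp add: pin_group_def cl_scalar_one)
  finally have "r\<^sup>2 = 1"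
    by (rule injD[OF inj_cl_scalar])
  then have "r = 1"
    by (rule laurent_square_eq_1)
  then show "c = d"
    using r by (simp add: cl_scalar_one)
qed

theorem lemma3p10:
  assumes "odd CARD('m::finite)"
  shows "clifford_pi \<in> (clifford_group :: 'm clifford set) \<rightarrow> orthogonal_group
    \<and> inj_on clifford_pi (pin_group :: 'm clifford set)
    \<and> inj_on clifford_pi (spin_group :: 'm clifford set)"
  using clifford_pi_orthogonal[OF assms] inj_on_clifford_pi_pin[OF assms]
  by (auto simp: spin_group_def intro: inj_on_subset)

end
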